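(* If $\mathfrak{b}<\mathfrak{b}_{\mathcal{J}}$ for some ideal $\mathcal{J}$ on $\omega$, then there are a weak P-ideal $\mathcal{I}$ on $\omega$ and an $\mathcal{I}$wQN-space which is not a wQN-space.
   Context: An ideal on $\omega$ is a proper subfamily of $\mathcal{P}(\omega)$ closed under finite unions and subsets and containing all finite sets; $\mathrm{Fin}$ is the ideal of finite sets. $\mathcal I$ is a weak P-ideal if for every partition $\{A_n:n\in\omega\}\subseteq\mathcal I$ of $\omega$ there is $A\notin\mathcal I$ with $A_n\cap A$ finite for all $n$. For $f,g\in\omega^\omega$ write $f\le_{\mathcal J}g$ if $\{n:f(n)>g(n)\}\in\mathcal J$; $\mathfrak b_{\mathcal J}$ is the minimal cardinality of a family unbounded in $(\omega^\omega,\le_{\mathcal J})$, and $\mathfrak b=\mathfrak b_{\mathrm{Fin}}$. A sequence of reals $(x_n)$ is $\mathcal I$-convergent to $x$ if $\{n:|x_n-x|\ge\varepsilon\}\in\mathcal I$ for all $\varepsilon>0$. A sequence $(f_n)\subseteq\mathbb R^X$ $\mathcal I$QN-converges to $f\in\mathbb R^X$ if there are positive reals $\varepsilon_n$, with $(\varepsilon_n)$ $\mathcal I$-convergent to $0$, such that $\{n:|f_n(x)-f(x)|\ge\varepsilon_n\}\in\mathcal I$ for each $x\in X$. For infinite $B\subseteq\omega$, $e_B:\omega\to B$ is its increasing enumeration. A topological space $X$ is an $\mathcal I$wQN-space if for every sequence of continuous functions $f_n:X\to\mathbb R$ converging pointwise to $0$ there is an infinite $B\subseteq\omega$ such that $(f_{e_B(n)})_n$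 $\mathcal I$QN-converges to $0$. A wQN-space is a $\mathrm{Fin}$wQN-space. *)

theory Defs
  imports "HOL-Analysis.Analysis" "HOL-Library.Disjoint_Sets" "HOL-Library.Infinite_Set"
begin

unbundle cardinal_syntax

definition ideal_on_omega :: "nat set set \<Rightarrow> bool" where
  "ideal_on_omega I \<longleftrightarrow>
     I \<subset> Pow UNIV \<and>
     (\<forall>A\<in>I. \<forall>B\<in>I. A \<union> B \<in> I) \<and>
     (\<forall>A\<in>I. \<forall>B. B \<subseteq> A \<longrightarrow> B \<in> I) \<and>
     (\<forall>A. finite A \<longrightarrow> A \<in> I)"

definition Fin :: "nat set set" where
  "Fin = {A. finite A}"

definition weak_P_ideal :: "nat set set \<Rightarrow> bool" where
  "weak_P_ideal I \<longleftrightarrow>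
     ideal_on_omega I \<and>
     (\<forall>A :: nat \<Rightarrow> nat set. partition_on UNIV (range A) \<and> range A \<subseteq> I \<longrightarrow>
        (\<exists>B. B \<notin> I \<and> (\<forall>n. finite (A n \<inter> B))))"

definition le_mod :: "nat set set \<Rightarrow> (nat \<Rightarrow> nat) \<Rightarrow> (nat \<Rightarrow> nat) \<Rightarrow> bool" where
  "le_mod J f g \<longleftrightarrow> {n. f n > g n} \<in> J"

definition unbounded_mod :: "nat set set \<Rightarrow> (nat \<Rightarrow> nat) set \<Rightarrow> bool" where
  "unbounded_mod J F \<longleftrightarrow> \<not> (\<exists>g. \<forall>f\<in>F. le_mod J f g)"

text \<open>Cardinals are represented by cardinal well-orders, to be compared by \<open>\<le>o\<close>, \<open><o\<close> and \<open>=o\<close>.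
  The chosen family exists by \<open>ex_least_unbounded_mod\<close> below, and its cardinality
  does not depend on the choice.\<close>

definition bounding_number :: "nat set set \<Rightarrow> (nat \<Rightarrow> nat) rel" where
  "bounding_number J =
     |SOME F. unbounded_mod J F \<and> (\<forall>G. unbounded_mod J G \<longrightarrow> |F| \<le>o |G| )|"

definition ideal_convergent :: "nat set set \<Rightarrow> (nat \<Rightarrow> real) \<Rightarrow> real \<Rightarrow> bool" where
  "ideal_convergent I x l \<longleftrightarrow> (\<forall>\<epsilon>>0. {n. \<bar>x n - l\<bar> \<ge> \<epsilon>} \<in> I)"

definition QN_converges ::
    "nat set set \<Rightarrow> 'a set \<Rightarrow> (nat \<Rightarrow> 'a \<Rightarrow> real) \<Rightarrow> ('a \<Rightarrow> real) \<Rightarrow> bool" where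
  "QN_converges I S f g \<longleftrightarrow>
     (\<exists>\<epsilon> :: nat \<Rightarrow> real. (\<forall>n. \<epsilon> n > 0) \<and> ideal_convergent I \<epsilon> 0 \<and>
        (\<forall>x\<in>S. {n. \<bar>f n x - g x\<bar> \<ge> \<epsilon> n} \<in> I))"

definition wQN_space_mod :: "nat set set \<Rightarrow> 'a topology \<Rightarrow> bool" where
  "wQN_space_mod I X \<longleftrightarrow>
     (\<forall>f :: nat \<Rightarrow> 'a \<Rightarrow> real.
        (\<forall>n. continuous_map X euclideanreal (f n)) \<and>
        (\<forall>x\<in>topspace X. (\<lambda>n. f n x) \<longlonglongrightarrow> 0) \<longrightarrow>
        (\<exists>B. infinite B \<and>
           QN_converges I (topspace X) (\<lambda>n. f (enumerate B n)) (\<lambda>_. 0)))"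

definition wQN_space :: "'a topology \<Rightarrow> bool" where
  "wQN_space X \<longleftrightarrow> wQN_space_mod Fin X"

lemma ideal_on_omega_Fin: "ideal_on_omega Fin"
  by (auto simp: ideal_on_omega_def Fin_def intro: finite_subset)

lemma unbounded_mod_UNIV:
  assumes "ideal_on_omega J"
  shows "unbounded_mod J UNIV"
proof -
  have "UNIV \<notin> J"
    using assms by (auto simp: ideal_on_omega_def)
  moreover have "{n. Suc (g n) > g n} = UNIV" for g :: "nat \<Rightarrow> nat"
    by auto
  ultimately have "\<not> le_mod J (\<lambda>n. Suc (g n)) g" for g
    by (simp add: le_mod_def)
  then show ?thesis
    unfolding unbounded_mod_def by blast
qed

lemma ex_least_unbounded_mod:
  assumes "ideal_on_omega J"
  shows "\<exists>F. unbounded_mod J F \<and> (\<forall>G. unbounded_mod J G \<longrightarrow> |F| \<le>o |G| )"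
proof -
  let ?R = "card_of ` {F. unbounded_mod J F}"
  have "?R \<noteq> {}"
    using unbounded_mod_UNIV[OF assms] by auto
  moreover have "\<forall>r\<in>?R. Well_order r"
    by (auto simp: card_of_Well_order)
  ultimately have "\<exists>r\<in>?R. \<forall>r'\<in>?R. r \<le>o r'"
    by (rule exists_minim_Well_order)
  then show ?thesis
    by simp
qed

lemma bounding_number_least:
  assumes "ideal_on_omega J"
  shows "\<exists>F. unbounded_mod J F \<and> bounding_number J = |F|"
    and "unbounded_mod J G \<Longrightarrow> bounding_number J \<le>o |G|"
proof -
  let ?P = "\<lambda>F. unbounded_mod J F \<and> (\<forall>G. unbounded_mod J G \<longrightarrow> |F| \<le>o |G| )"
  have P: "?P (SOME F. ?P F)"
    using ex_least_unbounded_mod[OF assms] by (rule someI_ex)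
  show "\<exists>F. unbounded_mod J F \<and> bounding_number J = |F|"
    unfolding bounding_number_def using P by (intro exI conjI) (rule conjunct1, assumption, rule refl)
  show "bounding_number J \<le>o |G|" if "unbounded_mod J G"
    unfolding bounding_number_def using conjunct2[OF P] that by simp
qed

end

(*
  On the pairs of natural numbers let I consist of the sets A such that almost all columns of A are
  finite and the set of nonempty columns belongs to J.

  I is a weak P-ideal: given a partition P k of the plane into members of I, suppose first that
  infinitely many columns meet every P k in a finite set; take, in the n-th of them, all points
  outside P 0, ..., P n. Otherwise almost every column n meets some P k in an infinite set, a given k
  occurs for only finitely many n, and one takes one point of such a P k in every column.

  A discrete space X of size b = |F|, with F unbounded modulo Fin, is not a wQN-space. For functions
  f j converging to 0 on X let h x k be a stage after which f j x stays below 1/(k+1). As |X| < b_J,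
  some g bounds all h x modulo J. Choose the subsequence c increasing with c (n,m) >= g n, and put
  eps (n,m) = 1/(n+1). Then |f (c (n,m)) x| >= eps (n,m) only if h x n > g n, which gives a set of
  columns in J, and only if h x n > c (n,m) >= m, which gives finitely many m for each n.
*)

theory Submission
  imports Defs "HOL-Library.Nat_Bijection"
begin

text \<open>Lets the infinite set that selects a subsequence be given as the range of a strictly
  increasing index function.\<close>

lemma enumerate_range_strict_mono:
  fixes c :: "nat \<Rightarrow> nat"
  assumes "strict_mono c"
  shows "enumerate (range c) n = c n"
proof (induction n)
  case 0
  show ?case
    unfolding enumerate_0
    by (rule Least_equality) (auto simp: strict_mono_less_eq[OF assms])
next
  case (Suc n)
  have inf: "infinite (range c)"
    using assms by (simp add: finite_image_iff strict_mono_imp_inj_on)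
  have "enumerate (range c) (Suc n) = (LEAST s. s \<in> range c \<and> enumerate (range c) n < s)"
    using inf by (rule enumerate_Suc'')
  also have "\<dots> = c (Suc n)"
    unfolding Suc.IH
    by (rule Least_equality)
      (auto simp: strict_mono_less_eq[OF assms] strict_mono_less[OF assms])
  finally show ?case .
qed

section \<open>The ideal on the plane and its weak P-property\<close>

definition column :: "nat set \<Rightarrow> nat \<Rightarrow> nat set" where
  "column A n = {m. prod_encode (n, m) \<in> A}"

text \<open>Read through \<open>prod_encode\<close>, this is the intersection of the Fubini products
  of \<open>Fin\<close> with \<open>Fin\<close> and of \<open>J\<close> with the ideal whose only
  member is the empty set.\<close>

definition column_ideal :: "nat set set \<Rightarrow> nat set set" where
  "column_ideal J = {A. finite {n. infinite (column A n)} \<and> {n. column A n \<noteq> {}} \<in> J}"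

lemma column_Un: "column (A \<union> B) n = column A n \<union> column B n"
  by (auto simp: column_def)

lemma column_mono: "A \<subseteq> B \<Longrightarrow> column A n \<subseteq> column B n"
  by (auto simp: column_def)

lemma finite_column: "finite A \<Longrightarrow> finite (column A n)"
  unfolding column_def by (rule finite_vimageI[of A "\<lambda>m. prod_encode (n, m)", unfolded vimage_def])
    (auto simp: inj_on_def)

lemma column_image_Sigma: "column (prod_encode ` Sigma N M) n = (if n \<in> N then M n else {})"
  by (auto simp: column_def inj_image_mem_iff[OF inj_prod_encode])

lemma ideal_on_omegaD:
  assumes "ideal_on_omega J"
  shows "UNIV \<notin> J" "finite A \<Longrightarrow> A \<in> J" "B \<in> J \<Longrightarrow> A \<subseteq> B \<Longrightarrow> A \<in> J"
    "A \<in> J \<Longrightarrow> B \<in> J \<Longrightarrow> A \<union> B \<in> J"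
  using assms unfolding ideal_on_omega_def by auto

lemma ideal_on_omega_column_ideal:
  assumes J: "ideal_on_omega J"
  shows "ideal_on_omega (column_ideal J)"
proof -
  have "UNIV \<notin> column_ideal J"
    by (simp add: column_ideal_def column_def)
  moreover have "A \<union> B \<in> column_ideal J" if "A \<in> column_ideal J" "B \<in> column_ideal J" for A B
  proof -
    have "{n. infinite (column (A \<union> B) n)}
        = {n. infinite (column A n)} \<union> {n. infinite (column B n)}"
      "{n. column (A \<union> B) n \<noteq> {}} = {n. column A n \<noteq> {}} \<union> {n. column B n \<noteq> {}}"
      by (auto simp: column_Un)
    then show ?thesis
      using that ideal_on_omegaD(4)[OF J] by (simp add: column_ideal_def)
  qed
  moreover have "B \<in> column_ideal J" if "A \<in> column_ideal J" "B \<subseteq> A" for A B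
  proof -
    have "{n. infinite (column B n)} \<subseteq> {n. infinite (column A n)}"
      "{n. column B n \<noteq> {}} \<subseteq> {n. column A n \<noteq> {}}"
      using column_mono[OF that(2)] by (auto dest: finite_subset)
    then show ?thesis
      using that ideal_on_omegaD(3)[OF J] finite_subset by (auto simp: column_ideal_def)
  qed
  moreover have "A \<in> column_ideal J" if "finite A" for A
  proof -
    have "{n. column A n \<noteq> {}} \<subseteq> (\<lambda>i. fst (prod_decode i)) ` A"
      by (force simp: column_def)
    then have "finite {n. column A n \<noteq> {}}"
      using that finite_surj by blast
    then show ?thesis
      using finite_column[OF that] ideal_on_omegaD(2)[OF J] by (simp add: column_ideal_def)
  qed
  ultimately show ?thesis
    unfolding ideal_on_omega_def by blast
qed

lemma weak_P_ideal_column_ideal: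
  assumes J: "ideal_on_omega J"
  shows "weak_P_ideal (column_ideal J)"
  unfolding weak_P_ideal_def
proof (intro conjI allI impI ideal_on_omega_column_ideal[OF J], elim conjE)
  fix P :: "nat \<Rightarrow> nat set"
  assume part: "partition_on UNIV (range P)" and sub: "range P \<subseteq> column_ideal J"
  have P: "finite {n. infinite (column (P k) n)}" for k
    using sub by (auto simp: column_ideal_def)
  \<comment> \<open>The sequence \<open>P\<close> may repeat pieces, so a common point identifies
    the pieces but not their indices.\<close>
  have disj: "P j = P k" if "i \<in> P j" "i \<in> P k" for i j k
    using part that unfolding partition_on_def disjoint_def by blast
  define E where "E = {n. \<forall>k. finite (column (P k) n)}"
  show "\<exists>B. B \<notin> column_ideal J \<and> (\<forall>k. finite (P k \<inter> B))"
  proof (cases "finite E")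
    case False
    \<comment> \<open>Only finitely many finite sets are removed from column \<open>n\<close>, and
      \<open>P k\<close> is among the removed pieces once \<open>n \<ge> k\<close>. So
      \<open>B\<close> violates the first clause of \<open>column_ideal\<close> and meets
      \<open>P k\<close> only in columns below \<open>k\<close>.\<close>
    define M where "M n = UNIV - (\<Union>k\<le>n. column (P k) n)" for n
    define B where "B = prod_encode ` Sigma E M"
    have "infinite (M n)" if "n \<in> E" for n
      using that unfolding M_def E_def by (intro Diff_infinite_finite) auto
    then have "E \<subseteq> {n. infinite (column B n)}"
      by (auto simp: B_def column_image_Sigma)
    then have "B \<notin> column_ideal J"
      using False finite_subset by (auto simp: column_ideal_def)
    moreover have "finite (P k \<inter> B)" for k
    proof -
      have "P k \<inter> B \<subseteq> prod_encode ` Sigma (E \<inter> {..<k}) (column (P k))"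
      proof
        fix i
        assume i: "i \<in> P k \<inter> B"
        then obtain n m where nm: "i = prod_encode (n, m)" "n \<in> E" "m \<in> M n"
          by (auto simp: B_def)
        then have "m \<in> column (P k) n"
          using i by (simp add: column_def)
        moreover have "n < k"
          using calculation nm(3) by (auto simp: M_def not_le[symmetric])
        ultimately show "i \<in> prod_encode ` Sigma (E \<inter> {..<k}) (column (P k))"
          using nm by blast
      qed
      moreover have "finite (Sigma (E \<inter> {..<k}) (column (P k)))"
        by (rule finite_SigmaI) (auto simp: E_def)
      ultimately show ?thesis
        using finite_subset by blast
    qed
    ultimately show ?thesis
      by blast
  next
    case True
    have "\<forall>n\<in>-E. \<exists>k m. infinite (column (P k) n) \<and> m \<in> column (P k) n"
    proof
      fix n
      assume "n \<in> -E"
      then obtain k where k: "infinite (column (P k) n)"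
        by (auto simp: E_def)
      then have "column (P k) n \<noteq> {}"
        by auto
      then show "\<exists>k m. infinite (column (P k) n) \<and> m \<in> column (P k) n"
        using k by blast
    qed
    then obtain \<kappa> \<mu> where \<kappa>: "infinite (column (P (\<kappa> n)) n)" "\<mu> n \<in> column (P (\<kappa> n)) n"
      if "n \<in> -E" for n
      by metis
    define B where "B = prod_encode ` Sigma (-E) (\<lambda>n. {\<mu> n})"
    have "{n. column B n \<noteq> {}} = -E"
      by (auto simp: B_def column_image_Sigma)
    \<comment> \<open>Otherwise \<open>UNIV\<close> would be the union of \<open>-E\<close> and the
      finite set \<open>E\<close>, both in \<open>J\<close>.\<close>
    moreover have "-E \<notin> J"
      using ideal_on_omegaD(4)[OF J, of "-E" E] ideal_on_omegaD(1,2)[OF J] True by auto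
    ultimately have "B \<notin> column_ideal J"
      by (simp add: column_ideal_def)
    moreover have "finite (P k \<inter> B)" for k
    proof -
      have "P k \<inter> B \<subseteq> (\<lambda>n. prod_encode (n, \<mu> n)) ` {n. infinite (column (P k) n)}"
      proof
        fix i
        assume i: "i \<in> P k \<inter> B"
        then obtain n where n: "n \<in> -E" "i = prod_encode (n, \<mu> n)"
          by (auto simp: B_def)
        \<comment> \<open>The point \<open>i\<close> lies in both pieces, hence column
          \<open>n\<close> of \<open>P k\<close> itself is infinite, which happens for finitely many
          \<open>n\<close> only.\<close>
        then have "P (\<kappa> n) = P k"
          using i \<kappa>(2)[OF n(1)] by (intro disj[of i]) (auto simp: column_def)
        then show "i \<in> (\<lambda>n. prod_encode (n, \<mu> n)) ` {n. infinite (column (P k) n)}"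
          using \<kappa>(1)[OF n(1)] n(2) by simp
      qed
      then show ?thesis
        using P[of k] finite_surj by blast
    qed
    ultimately show ?thesis
      by blast
  qed
qed

section \<open>Spaces with fewer points than the bounding number of \<open>J\<close>\<close>

lemma wQN_space_mod_column_ideal:
  fixes X :: "'a topology"
  assumes J: "ideal_on_omega J" and card: "|topspace X| <o bounding_number J"
  shows "wQN_space_mod (column_ideal J) X"
  unfolding wQN_space_mod_def
proof (intro allI impI, elim conjE)
  fix f :: "nat \<Rightarrow> 'a \<Rightarrow> real"
  assume lim: "\<forall>x\<in>topspace X. (\<lambda>n. f n x) \<longlonglongrightarrow> 0"
  have "\<forall>x\<in>topspace X. \<forall>k. \<exists>N. \<forall>n\<ge>N. \<bar>f n x\<bar> < 1 / real (Suc k)"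
  proof (intro ballI allI)
    fix x k
    assume "x \<in> topspace X"
    then have "\<exists>N. \<forall>n\<ge>N. norm (f n x - 0) < 1 / real (Suc k)"
      using lim by (intro LIMSEQ_D) auto
    then show "\<exists>N. \<forall>n\<ge>N. \<bar>f n x\<bar> < 1 / real (Suc k)"
      by simp
  qed
  then obtain h where h: "\<bar>f n x\<bar> < 1 / real (Suc k)" if "x \<in> topspace X" "n \<ge> h x k" for x k n
    by metis
  have "\<not> unbounded_mod J (h ` topspace X)"
  proof
    assume "unbounded_mod J (h ` topspace X)"
    then have "bounding_number J \<le>o |h ` topspace X|"
      by (rule bounding_number_least(2)[OF J])
    then have "bounding_number J \<le>o |topspace X|"
      using card_of_image ordLeq_transitive by blast
    then show False
      using card not_ordLess_ordLeq by blast
  qed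
  then obtain g where g: "le_mod J (h x) g" if "x \<in> topspace X" for x
    unfolding unbounded_mod_def by auto
  \<comment> \<open>The summand \<open>i\<close> makes \<open>c\<close> strictly increasing with
    \<open>c i \<ge> i\<close>; the partial sum dominates the value of \<open>g\<close> at the
    column of \<open>i\<close>.\<close>
  define c where "c i = i + (\<Sum>j\<le>i. g (fst (prod_decode j)))" for i
  have c: "strict_mono c"
    by (auto simp: strict_mono_Suc_iff c_def)
  have c_id: "i \<le> c i" for i
    by (simp add: c_def)
  have c_g: "g (fst (prod_decode i)) \<le> c i" for i
    unfolding c_def by (intro trans_le_add2 member_le_sum) auto
  define \<epsilon> where "\<epsilon> i = 1 / real (Suc (fst (prod_decode i)))" for i
  have "ideal_convergent (column_ideal J) \<epsilon> 0"
    unfolding ideal_convergent_def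
  proof (intro allI impI)
    fix \<delta> :: real
    assume "\<delta> > 0"
    then obtain N where N: "1 / real (Suc N) < \<delta>"
      using nat_approx_posE by blast
    have "n \<le> N" if "\<delta> \<le> 1 / real (Suc n)" for n
    proof (rule ccontr)
      assume "\<not> n \<le> N"
      then have "1 / real (Suc n) \<le> 1 / real (Suc N)"
        by (intro divide_left_mono) auto
      then show False
        using N that by linarith
    qed
    \<comment> \<open>Since \<open>\<epsilon>\<close> is constant on columns, the exceptional set is
      a union of finitely many whole columns. Infinite columns are allowed when there are finitely
      many, and \<open>J\<close> contains all finite sets.\<close>
    then have "{n. column {i. \<bar>\<epsilon> i - 0\<bar> \<ge> \<delta>} n \<noteq> {}} \<subseteq> {..N}"
      by (auto simp: column_def \<epsilon>_def)
    then have fin: "finite {n. column {i. \<bar>\<epsilon> i - 0\<bar> \<ge> \<delta>} n \<noteq> {}}"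
      using finite_subset by blast
    moreover have "{n. infinite (column {i. \<bar>\<epsilon> i - 0\<bar> \<ge> \<delta>} n)}
        \<subseteq> {n. column {i. \<bar>\<epsilon> i - 0\<bar> \<ge> \<delta>} n \<noteq> {}}"
      by auto
    ultimately show "{i. \<bar>\<epsilon> i - 0\<bar> \<ge> \<delta>} \<in> column_ideal J"
      using ideal_on_omegaD(2)[OF J] finite_subset unfolding column_ideal_def by blast
  qed
  moreover have "{i. \<bar>f (c i) x - 0\<bar> \<ge> \<epsilon> i} \<in> column_ideal J" (is "?A \<in> _")
    if x: "x \<in> topspace X" for x
  proof -
    have A: "c (prod_encode (n, m)) < h x n" if "m \<in> column ?A n" for n m
    proof (rule ccontr)
      assume "\<not> c (prod_encode (n, m)) < h x n"
      then show False
        using h[OF x, of n "c (prod_encode (n, m))"] that by (simp add: column_def \<epsilon>_def)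
    qed
    have "column ?A n \<subseteq> {..<h x n}" for n
    proof
      fix m
      assume "m \<in> column ?A n"
      then have "c (prod_encode (n, m)) < h x n"
        by (rule A)
      then show "m \<in> {..<h x n}"
        \<comment> \<open>This chains \<open>m \<le> prod_encode (n, m) \<le> c (prod_encode (n, m))
          < h x n\<close>.\<close>
        using le_prod_encode_2[of m n] c_id[of "prod_encode (n, m)"] by simp
    qed
    then have "{n. infinite (column ?A n)} = {}"
      using finite_subset by blast
    moreover have "{n. column ?A n \<noteq> {}} \<subseteq> {n. h x n > g n}"
    proof
      fix n
      assume "n \<in> {n. column ?A n \<noteq> {}}"
      then obtain m where "m \<in> column ?A n"
        by blast
      then show "n \<in> {n. h x n > g n}"
        using A[of m n] c_g[of "prod_encode (n, m)"] by simp
    qed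
    then have "{n. column ?A n \<noteq> {}} \<in> J"
      using g[OF x] ideal_on_omegaD(3)[OF J] unfolding le_mod_def by blast
    ultimately show ?thesis
      by (simp add: column_ideal_def)
  qed
  moreover have "\<epsilon> i > 0" for i
    by (simp add: \<epsilon>_def)
  moreover have "infinite (range c)"
    using c by (simp add: finite_image_iff strict_mono_imp_inj_on)
  ultimately show "\<exists>B. infinite B \<and>
      QN_converges (column_ideal J) (topspace X) (\<lambda>n. f (enumerate B n)) (\<lambda>_. 0)"
    unfolding QN_converges_def by (intro exI[of _ "range c"]) (auto simp: enumerate_range_strict_mono[OF c])
qed

section \<open>Discrete spaces that are not wQN\<close>

text \<open>The \<open>f n x\<close> are built so that \<open>e x k > n\<close> forces
  \<open>f n x \<ge> 1 / (k + 1)\<close>. If a subsequence converged in the QN sense, choosing for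
  each \<open>k\<close> a late index with control below \<open>1 / (k + 1)\<close> would bound all
  \<open>e x\<close> modulo \<open>Fin\<close>.\<close>

lemma not_wQN_space_discrete:
  fixes e :: "'a \<Rightarrow> nat \<Rightarrow> nat"
  assumes unb: "unbounded_mod Fin (e ` S)"
  shows "\<not> wQN_space (discrete_topology S)"
proof
  assume wQN: "wQN_space (discrete_topology S)"
  define f :: "nat \<Rightarrow> 'a \<Rightarrow> real" where
    \<comment> \<open>The value 0 stands for an infinite least index, when \<open>n\<close> bounds
      all values of \<open>e x\<close>.\<close>
    "f n x = (if \<exists>k. e x k > n then 1 / real (Suc (LEAST k. e x k > n)) else 0)" for n x
  have f_ge: "f n x \<ge> 1 / real (Suc k)" if "e x k > n" for n x k
  proof -
    have "(LEAST k. e x k > n) \<le> k"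
      using that by (rule Least_le)
    then have "1 / real (Suc k) \<le> 1 / real (Suc (LEAST k. e x k > n))"
      by (intro divide_left_mono) auto
    then show ?thesis
      using that by (auto simp: f_def)
  qed
  have f_nonneg: "f n x \<ge> 0" for n x
    by (simp add: f_def)
  have "(\<lambda>n. f n x) \<longlonglongrightarrow> 0" for x
  proof (rule LIMSEQ_I)
    fix r :: real
    assume "r > 0"
    then obtain N where N: "1 / real (Suc N) < r"
      using nat_approx_posE by blast
    \<comment> \<open>Past this sum no \<open>k \<le> N\<close> satisfies \<open>e x k > n\<close>,
      so the least such \<open>k\<close> is beyond \<open>N\<close>.\<close>
    have "f n x < r" if n: "n \<ge> (\<Sum>k\<le>N. e x k)" for n
    proof (cases "\<exists>k. e x k > n")
      case True
      define k where "k = (LEAST k. e x k > n)"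
      have "e x k > n"
        unfolding k_def using True by (rule LeastI_ex)
      moreover have "e x k \<le> n" if "k \<le> N"
        using n member_le_sum[of k "{..N}" "e x"] that by simp
      ultimately have "N \<le> k"
        by force
      then have "1 / real (Suc k) \<le> 1 / real (Suc N)"
        by (intro divide_left_mono) auto
      then show ?thesis
        using N True by (simp add: f_def k_def)
    next
      case False
      then show ?thesis
        using \<open>r > 0\<close> by (simp add: f_def)
    qed
    then show "\<exists>N. \<forall>n\<ge>N. norm (f n x - 0) < r"
      using f_nonneg by auto
  qed
  \<comment> \<open>On a discrete space continuity of the \<open>f n\<close> is automatic.\<close>
  then obtain B where "QN_converges Fin S (\<lambda>n. f (enumerate B n)) (\<lambda>_. 0)"
    using wQN unfolding wQN_space_def wQN_space_mod_def by fastforce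
  then obtain \<epsilon> where \<epsilon>: "ideal_convergent Fin \<epsilon> 0"
    and f_\<epsilon>: "\<And>x. x \<in> S \<Longrightarrow> finite {n. \<bar>f (enumerate B n) x\<bar> \<ge> \<epsilon> n}"
    unfolding QN_converges_def Fin_def by auto
  \<comment> \<open>Asking for \<open>m \<ge> k\<close> ensures that finitely many exceptional
    indices \<open>g k\<close> come from finitely many \<open>k\<close>.\<close>
  have "\<exists>m\<ge>k. \<bar>\<epsilon> m\<bar> < 1 / real (Suc k)" for k
  proof -
    have "finite {n. \<bar>\<epsilon> n\<bar> \<ge> 1 / real (Suc k)}"
      using \<epsilon> unfolding ideal_convergent_def Fin_def by simp
    then have "finite ({n. \<bar>\<epsilon> n\<bar> \<ge> 1 / real (Suc k)} \<union> {..<k})"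
      by simp
    then obtain m where "m \<notin> {n. \<bar>\<epsilon> n\<bar> \<ge> 1 / real (Suc k)} \<union> {..<k}"
      using ex_new_if_finite infinite_UNIV_nat by blast
    then have "m \<ge> k" "\<bar>\<epsilon> m\<bar> < 1 / real (Suc k)"
      by (simp_all add: not_le not_less)
    then show ?thesis
      by blast
  qed
  then obtain g where g: "g k \<ge> k" "\<bar>\<epsilon> (g k)\<bar> < 1 / real (Suc k)" for k
    by metis
  have "le_mod Fin (e x) (\<lambda>k. enumerate B (g k))" if "x \<in> S" for x
  proof -
    obtain N where N: "\<And>n. \<bar>f (enumerate B n) x\<bar> \<ge> \<epsilon> n \<Longrightarrow> n \<le> N"
      using f_\<epsilon>[OF \<open>x \<in> S\<close>] unfolding finite_nat_set_iff_bounded_le by auto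
    have "k \<le> N" if "e x k > enumerate B (g k)" for k
      using f_ge[OF that] g[of k] N[of "g k"] by linarith
    then show ?thesis
      unfolding le_mod_def Fin_def finite_nat_set_iff_bounded_le by auto
  qed
  then show False
    using unb unfolding unbounded_mod_def by blast
qed

theorem theorem2p11:
  fixes J :: "nat set set"
  assumes "ideal_on_omega J"
    and "bounding_number Fin <o bounding_number J"
  shows "\<exists>(I :: nat set set) (X :: (nat \<Rightarrow> real) topology).
           weak_P_ideal I \<and> wQN_space_mod I X \<and> \<not> wQN_space X"
proof -
  obtain F where F: "unbounded_mod Fin F" "bounding_number Fin = |F|"
    using bounding_number_least(1)[OF ideal_on_omega_Fin] by blast
  \<comment> \<open>The points of the space have to be real sequences, so \<open>F\<close> is copied
    into that type; taking floors recovers it.\<close>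
  define S :: "(nat \<Rightarrow> real) set" where "S = (\<lambda>x n. real (x n)) ` F"
  have "(\<lambda>y n. nat \<lfloor>y n\<rfloor>) ` S = F"
    by (simp add: S_def image_image)
  then have "\<not> wQN_space (discrete_topology S)"
    using F(1) by (intro not_wQN_space_discrete[of "\<lambda>y n. nat \<lfloor>y n\<rfloor>"]) simp
  moreover have "|S| <o bounding_number J"
    using assms(2) F(2) card_of_image[of "\<lambda>x n. real (x n)" F] ordLeq_ordLess_trans
    unfolding S_def by metis
  then have "wQN_space_mod (column_ideal J) (discrete_topology S)"
    by (intro wQN_space_mod_column_ideal[OF assms(1)]) simp
  ultimately show ?thesis
    using weak_P_ideal_column_ideal[OF assms(1)] by blast
qed

end
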